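(* Let $\ell\in\mathbb N$. There exists an acute lattice triangle of lattice perimeter $\ell$ whose orthocenter is a lattice point if and only if $\ell=6$ or $\ell\ge 8$.
   Context: $\mathbb N$ denotes the positive integers. A lattice point is an element of $\mathbb Z^2\subseteq\mathbb R^2$. A lattice triangle is a (nondegenerate) triangle in $\mathbb R^2$ whose three vertices are lattice points. The lattice length of a segment joining two lattice points is the number of lattice points on the segment (endpoints included) minus one. The lattice perimeter of a lattice triangle is the sum of the lattice lengths of its three sides. A triangle is acute if all its interior angles are strictly less than $\pi/2$. *)

theory Defs
  imports "HOL-Analysis.Analysis"
begin

definition lattice_points :: "(real^2) set" where
  "lattice_points = {P. \<forall>i. P $ i \<in> \<int>}"

definition lattice_triangle :: "real^2 \<Rightarrow> real^2 \<Rightarrow> real^2 \<Rightarrow> bool" where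
  "lattice_triangle A B C \<longleftrightarrow>
     A \<in> lattice_points \<and> B \<in> lattice_points \<and> C \<in> lattice_points \<and> \<not> collinear {A, B, C}"

text \<open>For lattice points \<open>P\<close> and \<open>Q\<close> the set below is finite and nonempty, so neither the
  cardinality nor the truncated subtraction takes a junk value.\<close>

definition lattice_length :: "real^2 \<Rightarrow> real^2 \<Rightarrow> nat" where
  "lattice_length P Q = card (closed_segment P Q \<inter> lattice_points) - 1"

definition lattice_perimeter :: "real^2 \<Rightarrow> real^2 \<Rightarrow> real^2 \<Rightarrow> nat" where
  "lattice_perimeter A B C = lattice_length A B + lattice_length B C + lattice_length C A"

text \<open>The interior angle at the vertex \<open>A\<close> of the triangle \<open>A B C\<close>.\<close>

definition interior_angle :: "real^2 \<Rightarrow> real^2 \<Rightarrow> real^2 \<Rightarrow> real" where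
  "interior_angle A B C = arccos (((B - A) \<bullet> (C - A)) / (norm (B - A) * norm (C - A)))"

definition acute_triangle :: "real^2 \<Rightarrow> real^2 \<Rightarrow> real^2 \<Rightarrow> bool" where
  "acute_triangle A B C \<longleftrightarrow>
     interior_angle A B C < pi / 2 \<and> interior_angle B C A < pi / 2 \<and> interior_angle C A B < pi / 2"

text \<open>The altitude from \<open>A\<close>, as a full line: all points \<open>P\<close> with \<open>P - A\<close> perpendicular
  to the side \<open>B C\<close>.\<close>

definition altitude :: "real^2 \<Rightarrow> real^2 \<Rightarrow> real^2 \<Rightarrow> (real^2) set" where
  "altitude A B C = {P. orthogonal (P - A) (C - B)}"

definition is_orthocenter :: "real^2 \<Rightarrow> real^2 \<Rightarrow> real^2 \<Rightarrow> real^2 \<Rightarrow> bool" where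
  "is_orthocenter H A B C \<longleftrightarrow> altitude A B C \<inter> altitude B C A \<inter> altitude C A B = {H}"

end

theory Submission
  imports Defs
begin

text \<open>
  Translate the orthocenter to the origin, so that the vertices are integer vectors \<open>a, b, c\<close> with
  \<open>a \<bullet> b = b \<bullet> c = c \<bullet> a = -K\<close>, where \<open>K > 0\<close> by acuteness.  Let \<open>p, q, r\<close> be the lattice
  lengths of the sides opposite to \<open>a, b, c\<close>, and let \<open>d1, d2, d3\<close> be the contents (gcd of the
  coordinates) of \<open>a, b, c\<close>.  The side opposite to \<open>a\<close> is perpendicular to \<open>a\<close>, so the angle at
  \<open>a\<close> has tangent \<open>p / d1\<close>, and the identity \<open>tan \<alpha> + tan \<beta> + tan \<gamma> = tan \<alpha> tan \<beta> tan \<gamma>\<close> becomes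
  \<open>p d2 d3 + q d1 d3 + r d1 d2 = p q r\<close>.  For \<open>p + q + r \<in> {3, 4, 5, 7}\<close> the only solutions are, up
  to symmetry, \<open>(p, q, r) = (2, 2, 3)\<close> and \<open>(d1, d2, d3) = (1, 2, 1)\<close>; there \<open>a\<close> would be a primitive
  vector whose squared length \<open>2 K\<close> is divisible by 4.

  Conversely, the triangle \<open>(0, h), (-u, 0), (v, 0)\<close> with \<open>u v = h w\<close> and \<open>0 < w < h\<close> is acute
  with orthocenter \<open>(0, w)\<close> and perimeter \<open>u + v + gcd u h + gcd v h\<close>; the choices
  \<open>(u, v, h) = (k, n, n)\<close> with \<open>k \<in> {1, 2, 4}\<close>, and \<open>(6, 1, 3)\<close> for perimeter 11, suffice.
\<close>

section \<open>Orthocentric triples of integer vectors\<close>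

text \<open>After division by \<open>d\<close> the vector is a primitive \<open>(x, y)\<close>, and
  an integer vector perpendicular to it is an integer multiple of \<open>(-y, x)\<close>. The sign
  of \<open>p\<close> records the orientation.\<close>

lemma perpendicular_multiple_int:
  fixes a1 a2 e1 e2 :: int
  assumes "a1 * e1 + a2 * e2 = 0" and "gcd a1 a2 \<noteq> 0"
  obtains p where "\<bar>p\<bar> = gcd e1 e2"
    and "gcd a1 a2 * e1 = - p * a2" and "gcd a1 a2 * e2 = p * a1"
proof -
  define d where "d = gcd a1 a2"
  obtain x y where xy: "a1 = x * d" "a2 = y * d" "coprime x y"
    using gcd_coprime_exists[OF assms(2)] d_def by metis
  obtain s t where st: "s * x + t * y = 1"
    using bezout_int[of x y] xy(3) by auto
  have "d \<noteq> 0" using assms(2) d_def by simp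
  have "d * (x * e1 + y * e2) = 0" using assms(1) xy by algebra
  then have perp: "x * e1 + y * e2 = 0" using \<open>d \<noteq> 0\<close> by simp
  \<comment> \<open>If \<open>(e1, e2) = p * (-y, x)\<close>, then \<open>s * x + t * y = 1\<close>
    forces this value.\<close>
  define p where "p = s * e2 - t * e1"
  have e2: "e2 = p * x" using perp st p_def by algebra
  have e1: "e1 = - (p * y)" using perp st p_def by algebra
  have "gcd e1 e2 = gcd (p * y) (p * x)" using e1 e2 by simp
  also have "\<dots> = \<bar>p\<bar>" using xy(3) by (simp add: gcd_mult_distrib_int[symmetric] gcd.commute)
  finally show ?thesis
    using that[of p] e1 e2 xy(1,2) unfolding d_def[symmetric] by (simp add: algebra_simps)
qed

text \<open>Coprime numbers of equal parity are both odd, and two odd squares sum to 2 modulo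
  4.\<close>

lemma coprime_sum_squares_not_dvd_4:
  fixes x y :: int
  assumes "coprime x y"
  shows "\<not> 4 dvd x * x + y * y"
proof
  assume 4: "4 dvd x * x + y * y"
  then have "even (x * x + y * y)" by (meson dvd_trans even_numeral)
  then have "even x \<longleftrightarrow> even y" by auto
  moreover have "\<not> (even x \<and> even y)"
    using coprime_common_divisor[OF assms, of 2] by auto
  ultimately obtain k l where "x = 2 * k + 1" "y = 2 * l + 1" by (meson oddE)
  then have "x * x + y * y = 4 * (k * k + k + l * l + l) + 2" by algebra
  then show False using 4 by presburger
qed

text \<open>The sum bound leaves finitely many \<open>(p, q, r)\<close>, and for these the equation
  forces each \<open>d\<close> below 3, so enumeration finishes. The disjuncts are cyclic rotations
  of one another.\<close>

lemma tangent_equation_small: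
  fixes p q r d1 d2 d3 :: int
  assumes pos: "p > 0" "q > 0" "r > 0" "d1 > 0" "d2 > 0" "d3 > 0"
    and eq: "p * (d2 * d3) + q * (d1 * d3) + r * (d1 * d2) = p * q * r"
    and sum: "p + q + r \<noteq> 6" "p + q + r < 8"
  shows "(d1 = 1 \<and> d2 * d3 = 2 \<and> q * r = 6) \<or> (d2 = 1 \<and> d3 * d1 = 2 \<and> r * p = 6) \<or>
    (d3 = 1 \<and> d1 * d2 = 2 \<and> p * q = 6)"
proof -
  have triples: "(x, y, z) \<in> {(1,1,1), (1,1,2), (1,2,1), (2,1,1), (1,1,3), (1,3,1), (3,1,1),
      (1,2,2), (2,1,2), (2,2,1), (1,1,5), (1,5,1), (5,1,1), (1,2,4), (1,4,2), (2,1,4), (2,4,1),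
      (4,1,2), (4,2,1), (1,3,3), (3,1,3), (3,3,1), (2,2,3), (2,3,2), (3,2,2)}"
    if "x > 0" "y > 0" "z > 0" and sum: "x + y + z \<noteq> 6" "x + y + z < 8" for x y z :: int
  proof -
    have "x \<in> {1,2,3,4,5}" "y \<in> {1,2,3,4,5}" "z \<in> {1,2,3,4,5}" using that by auto
    then show ?thesis using sum by (elim insertE emptyE; simp)
  qed
  have bound: "d \<in> {1, 2}"
    if pos: "x > 0" "y > 0" "z > 0" "d > 0" "e > 0" "f > 0"
      and eq: "x * (e * f) + y * (d * f) + z * (d * e) = x * y * z"
      and sum: "x + y + z \<noteq> 6" "x + y + z < 8" for x y z d e f :: int
  proof -
    have "x * (e * f) > 0" "y * (d * f) \<ge> y * d" "z * (d * e) \<ge> z * d" using pos by simp_all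
    then have lt: "d * (y + z) < x * y * z" using eq by (simp add: algebra_simps)
    \<comment> \<open>Checked triple by triple; equality occurs at \<open>(3, 2, 2)\<close>.\<close>
    have "x * y * z \<le> 3 * (y + z)" using triples[OF pos(1-3) sum] by auto
    then have "d * (y + z) < 3 * (y + z)" using lt by simp
    then have "d < 3" using pos(2,3) by (simp only: mult_less_cancel_right)
    then show ?thesis using \<open>d > 0\<close> by auto
  qed
  have "d1 \<in> {1, 2}" using bound[OF pos eq sum] .
  moreover have "d2 \<in> {1, 2}" using bound[of q r p d2 d3 d1] pos eq sum by (simp add: ac_simps)
  moreover have "d3 \<in> {1, 2}" using bound[of r p q d3 d1 d2] pos eq sum by (simp add: ac_simps)
  ultimately show ?thesis using triples[OF pos(1-3) sum] eq by (elim insertE emptyE; simp)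
qed

lemma orthocentric_int_perimeter:
  fixes a1 a2 b1 b2 c1 c2 K :: int
  assumes ab: "a1 * b1 + a2 * b2 = - K" and bc: "b1 * c1 + b2 * c2 = - K"
    and ca: "c1 * a1 + c2 * a2 = - K"
    and acute: "a1 * a1 + a2 * a2 + K > 0" "b1 * b1 + b2 * b2 + K > 0" "c1 * c1 + c2 * c2 + K > 0"
  defines "p \<equiv> gcd (c1 - b1) (c2 - b2)" and "q \<equiv> gcd (a1 - c1) (a2 - c2)"
    and "r \<equiv> gcd (b1 - a1) (b2 - a2)"
  shows "p + q + r = 6 \<or> p + q + r \<ge> 8"
proof (rule ccontr)
  assume small: "\<not> ?thesis"
  define \<alpha> \<beta> \<gamma> where "\<alpha> = a1 * a1 + a2 * a2 + K" and "\<beta> = b1 * b1 + b2 * b2 + K"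
    and "\<gamma> = c1 * c1 + c2 * c2 + K"
  \<comment> \<open>Twice the signed areas of the triangles spanned by the origin and each side, so
    \<open>X + Y + Z\<close> is twice the signed area of the whole triangle. As \<alpha> is the
    inner product of the two sides at \<open>a\<close>, the relation \<open>S\<close> below says
    that the tangent at \<open>a\<close> is \<open>X / K\<close> up to sign.\<close>
  define X Y Z where "X = b1 * c2 - b2 * c1" and "Y = c1 * a2 - c2 * a1" and "Z = a1 * b2 - a2 * b1"
  have pos: "\<alpha> > 0" "\<beta> > 0" "\<gamma> > 0" using acute by (simp_all add: \<alpha>_def \<beta>_def \<gamma>_def)
  have YZ: "Y * Z = K * \<alpha>" unfolding Y_def Z_def \<alpha>_def using ab bc ca by algebra
  have ZX: "Z * X = K * \<beta>" unfolding X_def Z_def \<beta>_def using ab bc ca by algebra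
  have XY: "X * Y = K * \<gamma>" unfolding X_def Y_def \<gamma>_def using ab bc ca by algebra
  have S: "\<alpha> * X = K * (X + Y + Z)"
    unfolding X_def Y_def Z_def \<alpha>_def using ab bc ca by algebra
  \<comment> \<open>the Gram determinant of three vectors in the plane vanishes\<close>
  have "\<alpha> * \<beta> * \<gamma> = K * (\<alpha> * \<beta> + \<beta> * \<gamma> + \<gamma> * \<alpha>)"
    unfolding \<alpha>_def \<beta>_def \<gamma>_def using ab bc ca by algebra
  moreover have "\<alpha> * \<beta> * \<gamma> > 0" "\<alpha> * \<beta> + \<beta> * \<gamma> + \<gamma> * \<alpha> > 0" using pos by (simp_all add: add_pos_pos)
  ultimately have K: "K > 0" by (metis zero_less_mult_pos2)
  have sgn: "Y * Z > 0" "Z * X > 0" "X * Y > 0" using YZ ZX XY K pos by simp_all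
  \<comment> \<open>The tangent sum identity without denominators; \<open>X\<close>,
    \<open>Y\<close>, \<open>Z\<close> have the same sign.\<close>
  have S': "\<bar>X\<bar> * \<bar>Y\<bar> * \<bar>Z\<bar> = K * K * (\<bar>X\<bar> + \<bar>Y\<bar> + \<bar>Z\<bar>)"
  proof -
    have "X * Y * Z = K * K * (X + Y + Z)" using YZ S by algebra
    then have "\<bar>X * Y * Z\<bar> = K * K * \<bar>X + Y + Z\<bar>" using K by (simp add: abs_mult)
    moreover have "\<bar>X + Y + Z\<bar> = \<bar>X\<bar> + \<bar>Y\<bar> + \<bar>Z\<bar>"
      using sgn by (auto simp: zero_less_mult_iff)
    ultimately show ?thesis by (simp add: abs_mult)
  qed
  define d1 d2 d3 where "d1 = gcd a1 a2" and "d2 = gcd b1 b2" and "d3 = gcd c1 c2"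
  have "d1 \<noteq> 0" "d2 \<noteq> 0" "d3 \<noteq> 0" using ab bc ca K by (auto simp: d1_def d2_def d3_def)
  then have d: "d1 > 0" "d2 > 0" "d3 > 0" by (simp_all add: d1_def d2_def d3_def)
  \<comment> \<open>The tangent as a ratio of side length to content: the side is
    \<open>m / gcd x1 x2\<close> times the rotated \<open>x\<close>, and pairing this with
    \<open>y\<close> brings in \<open>K\<close>.\<close>
  have tan: "gcd x1 x2 * \<bar>y1 * z2 - y2 * z1\<bar> = gcd (z1 - y1) (z2 - y2) * K"
    if xy: "x1 * y1 + x2 * y2 = - K" and zx: "z1 * x1 + z2 * x2 = - K" and nz: "gcd x1 x2 \<noteq> 0"
    for x1 x2 y1 y2 z1 z2 :: int
  proof -
    have "x1 * (z1 - y1) + x2 * (z2 - y2) = 0" using xy zx by algebra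
    then obtain m where m: "\<bar>m\<bar> = gcd (z1 - y1) (z2 - y2)"
      "gcd x1 x2 * (z1 - y1) = - m * x2" "gcd x1 x2 * (z2 - y2) = m * x1"
      using perpendicular_multiple_int nz by metis
    have "gcd x1 x2 * (y1 * z2 - y2 * z1) = - m * K" using m(2,3) xy by algebra
    then have "\<bar>gcd x1 x2 * (y1 * z2 - y2 * z1)\<bar> = \<bar>m\<bar> * K" using K by (simp add: abs_mult)
    then show ?thesis using m(1) by (simp add: abs_mult)
  qed
  have X: "d1 * \<bar>X\<bar> = p * K" unfolding X_def d1_def p_def
    using tan[OF ab ca] \<open>d1 \<noteq> 0\<close> d1_def by simp
  have Y: "d2 * \<bar>Y\<bar> = q * K" unfolding Y_def d2_def q_def
    using tan[OF bc ab] \<open>d2 \<noteq> 0\<close> d2_def by simp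
  have Z: "d3 * \<bar>Z\<bar> = r * K" unfolding Z_def d3_def r_def
    using tan[OF ca bc] \<open>d3 \<noteq> 0\<close> d3_def by simp
  have "X \<noteq> 0" "Y \<noteq> 0" "Z \<noteq> 0" using sgn by auto
  then have pqr: "p > 0" "q > 0" "r > 0"
    using X Y Z d K by (metis zero_less_abs_iff zero_less_mult_pos2 mult_pos_pos)+
  have "(K * K * K) * (p * q * r) = (K * K * K) * (p * (d2 * d3) + q * (d1 * d3) + r * (d1 * d2))"
  proof -
    have "(K * K * K) * (p * q * r) = (p * K) * (q * K) * (r * K)" by simp
    also have "\<dots> = d1 * d2 * d3 * (\<bar>X\<bar> * \<bar>Y\<bar> * \<bar>Z\<bar>)" by (simp flip: X Y Z)
    also have "\<dots> = K * K * ((d1 * \<bar>X\<bar>) * (d2 * d3) + (d2 * \<bar>Y\<bar>) * (d1 * d3) + (d3 * \<bar>Z\<bar>) * (d1 * d2))"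
      unfolding S' by (simp add: algebra_simps)
    finally show ?thesis unfolding X Y Z by (simp add: algebra_simps)
  qed
  then have eq: "p * (d2 * d3) + q * (d1 * d3) + r * (d1 * d2) = p * q * r" using K by simp
  \<comment> \<open>This excludes \<open>(p, q, r) = (2, 2, 3)\<close>.\<close>
  have exceptional: False
    if "gcd x1 x2 = 1" and "gcd y1 y2 * gcd z1 z2 = 2" and "m * n = 6"
      and "y1 * z1 + y2 * z2 = - K" and "V * W = K * (x1 * x1 + x2 * x2 + K)" and "V * W > 0"
      and "gcd y1 y2 * \<bar>V\<bar> = m * K" and "gcd z1 z2 * \<bar>W\<bar> = n * K"
    for x1 x2 y1 y2 z1 z2 m n V W :: int
  proof -
    define s where "s = x1 * x1 + x2 * x2 + K"
    have VW: "\<bar>V\<bar> * \<bar>W\<bar> = K * s" using that(5,6) by (simp add: s_def flip: abs_mult)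
    have "K * (m * n * K) = (m * K) * (n * K)" by simp
    also have "\<dots> = gcd y1 y2 * gcd z1 z2 * (\<bar>V\<bar> * \<bar>W\<bar>)" by (simp flip: that(7,8))
    also have "\<dots> = K * (gcd y1 y2 * gcd z1 z2 * s)" unfolding VW by simp
    \<comment> \<open>With products 6 and 2 this reads \<open>6 * K = 2 * s\<close>, that is,
      \<open>x\<close> has squared length \<open>2 * K\<close>.\<close>
    finally have "m * n * K = gcd y1 y2 * gcd z1 z2 * s" using K by simp
    then have sq: "x1 * x1 + x2 * x2 = 2 * K" using that(2,3) by (simp add: s_def)
    \<comment> \<open>The contents of \<open>y\<close> and \<open>z\<close> divide their inner
      product \<open>- K\<close>, so \<open>K\<close> is even.\<close>
    have "gcd y1 y2 * gcd z1 z2 dvd y1 * z1 + y2 * z2" by (intro dvd_add mult_dvd_mono) auto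
    then have "even K" using that(2,4) by simp
    then have "4 dvd x1 * x1 + x2 * x2" using sq by auto
    then show False using coprime_sum_squares_not_dvd_4 that(1) coprime_iff_gcd_eq_1 by blast
  qed
  have "p + q + r \<noteq> 6" "p + q + r < 8" using small by auto
  from tangent_equation_small[OF pqr d eq this] show False
    using exceptional[OF _ _ _ bc YZ[unfolded \<alpha>_def] sgn(1) Y[unfolded d2_def] Z[unfolded d3_def]]
      exceptional[OF _ _ _ ca ZX[unfolded \<beta>_def] sgn(2) Z[unfolded d3_def] X[unfolded d1_def]]
      exceptional[OF _ _ _ ab XY[unfolded \<gamma>_def] sgn(3) X[unfolded d1_def] Y[unfolded d2_def]]
    unfolding d1_def d2_def d3_def by metis
qed

section \<open>Lattice geometry in coordinates\<close>

lemma lattice_points_2: "P \<in> lattice_points \<longleftrightarrow> P $ 1 \<in> \<int> \<and> P $ 2 \<in> \<int>"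
  by (simp add: lattice_points_def forall_2)

lemma inner_real2: "x \<bullet> y = x $ 1 * y $ 1 + x $ 2 * y $ 2" for x y :: "real^2"
  by (simp add: inner_vec_def sum_2)

text \<open>The lattice points on the segment are \<open>P\<close> plus 0 to \<open>g\<close> copies
  of the primitive vector \<open>(x', y')\<close>.\<close>

lemma lattice_length_eq_gcd:
  fixes P Q :: "real^2"
  assumes P: "P \<in> lattice_points"
    and Q: "Q $ 1 - P $ 1 = of_int x" "Q $ 2 - P $ 2 = of_int y"
  shows "int (lattice_length P Q) = gcd x y"
proof (cases "gcd x y = 0")
  case True
  then have "P = Q" using Q by (simp add: vec_eq_iff forall_2)
  moreover have "{Q} \<inter> lattice_points \<subseteq> {Q}" by blast
  then have "card ({Q} \<inter> lattice_points) \<le> 1" using card_mono[of "{Q}"] by fastforce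
  ultimately show ?thesis using True by (simp add: lattice_length_def)
next
  case False
  define g where "g = gcd x y"
  have g: "g > 0" using False by (simp add: g_def)
  obtain x' y' where x': "x = g * x'" and y': "y = g * y'"
    unfolding g_def by (metis dvd_def gcd_dvd1 gcd_dvd2)
  have Q': "Q - P = real_of_int g *\<^sub>R vector [real_of_int x', real_of_int y']"
    using Q x' y' by (simp add: vec_eq_iff forall_2)
  define f where "f k = P + real_of_int k *\<^sub>R vector [real_of_int x', real_of_int y']" for k :: int
  have "x \<noteq> 0 \<or> y \<noteq> 0" using False by simp
  then have "x' \<noteq> 0 \<or> y' \<noteq> 0" unfolding x' y' by (metis mult_zero_right)
  then have "vector [real_of_int x', real_of_int y'] \<noteq> (0 :: real^2)"
    by (simp add: vec_eq_iff forall_2)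
  then have "inj f" by (simp add: inj_def f_def)
  have "closed_segment P Q \<inter> lattice_points = f ` {0..g}"
  proof (intro equalityI subsetI)
    fix R assume R: "R \<in> closed_segment P Q \<inter> lattice_points"
    then obtain s where s: "0 \<le> s" "s \<le> 1" and "R = (1 - s) *\<^sub>R P + s *\<^sub>R Q"
      by (auto simp: in_segment)
    then have R': "R = P + s *\<^sub>R (Q - P)" by (simp add: algebra_simps)
    have "s * of_int x = R $ 1 - P $ 1" "s * of_int y = R $ 2 - P $ 2"
      unfolding R' by (simp_all add: Q)
    then have "s * of_int x \<in> \<int>" "s * of_int y \<in> \<int>"
      using R P by (auto simp: lattice_points_2)
    then obtain i j where ij: "s * of_int x = of_int i" "s * of_int y = of_int j" by (auto elim!: Ints_cases)
    \<comment> \<open>By Bezout, integrality of \<open>s * x\<close> and \<open>s * y\<close> passes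
      to \<open>s * g\<close>.\<close>
    obtain m n where "m * x + n * y = g" using bezout_int[of x y] g_def by auto
    then have "real_of_int g = of_int m * of_int x + of_int n * of_int y" by (metis of_int_add of_int_mult)
    then have "s * of_int g = of_int m * (s * of_int x) + of_int n * (s * of_int y)"
      by (simp add: algebra_simps)
    then have k: "s * of_int g = of_int (m * i + n * j)" using ij by simp
    then have "R = f (m * i + n * j)" unfolding R' Q' f_def by simp
    moreover have "0 \<le> s * of_int g" "s * of_int g \<le> of_int g"
      using s g by (simp_all add: mult_left_le_one_le)
    then have "m * i + n * j \<in> {0..g}" unfolding k of_int_0_le_iff of_int_le_iff by simp
    ultimately show "R \<in> f ` {0..g}" by blast
  next
    fix R assume "R \<in> f ` {0..g}"
    then obtain k where k: "0 \<le> k" "k \<le> g" "R = f k" by auto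
    have "R = P + (of_int k / of_int g) *\<^sub>R (Q - P)" unfolding k f_def Q' using g by simp
    then have "R = (1 - of_int k / of_int g) *\<^sub>R P + (of_int k / of_int g) *\<^sub>R Q"
      by (simp add: algebra_simps)
    moreover have "0 \<le> real_of_int k / of_int g" "real_of_int k / of_int g \<le> 1" using k g by auto
    ultimately have "R \<in> closed_segment P Q" unfolding in_segment by blast
    moreover have "R \<in> lattice_points" using P unfolding k f_def by (simp add: lattice_points_2)
    ultimately show "R \<in> closed_segment P Q \<inter> lattice_points" by blast
  qed
  then have "card (closed_segment P Q \<inter> lattice_points) = card {0..g}"
    using \<open>inj f\<close> by (metis card_image inj_on_subset subset_UNIV)
  then show ?thesis using g by (simp add: lattice_length_def nat_add_distrib flip: g_def)
qed

text \<open>\<open>arccos\<close> decreases strictly on [-1, 1] and takes the value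
  \<open>pi / 2\<close> at 0; Cauchy-Schwarz keeps the argument in that interval.\<close>

lemma interior_angle_acute_iff:
  assumes "B \<noteq> A" "C \<noteq> A"
  shows "interior_angle A B C < pi / 2 \<longleftrightarrow> (B - A) \<bullet> (C - A) > 0"
proof -
  let ?c = "((B - A) \<bullet> (C - A)) / (norm (B - A) * norm (C - A))"
  have n: "norm (B - A) * norm (C - A) > 0" using assms by simp
  have "\<bar>?c\<bar> \<le> 1" using Cauchy_Schwarz_ineq2[of "B - A" "C - A"] n by (simp add: abs_divide)
  then have "arccos ?c < arccos 0 \<longleftrightarrow> 0 < ?c" by (intro arccos_less_mono) auto
  also have "0 < ?c \<longleftrightarrow> (B - A) \<bullet> (C - A) > 0" using n by (metis zero_less_divide_iff order_less_asym)
  finally show ?thesis by (simp add: interior_angle_def)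
qed

lemma acute_triangle_iff:
  assumes "A \<noteq> B" "B \<noteq> C" "C \<noteq> A"
  shows "acute_triangle A B C \<longleftrightarrow> (B - A) \<bullet> (C - A) > 0 \<and> (C - B) \<bullet> (A - B) > 0 \<and>
    (A - C) \<bullet> (B - C) > 0"
  unfolding acute_triangle_def
  using interior_angle_acute_iff[of B A C] interior_angle_acute_iff[of C B A]
    interior_angle_acute_iff[of A C B] assms by blast

lemma lattice_perimeter_orthocentric:
  assumes tri: "lattice_triangle A B C" and acute: "acute_triangle A B C"
    and orth: "is_orthocenter H A B C" and H: "H \<in> lattice_points"
  shows "lattice_perimeter A B C = 6 \<or> lattice_perimeter A B C \<ge> 8"
proof -
  have lat: "A \<in> lattice_points" "B \<in> lattice_points" "C \<in> lattice_points"
    and nc: "\<not> collinear {A, B, C}" using tri by (auto simp: lattice_triangle_def)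
  have ne: "A \<noteq> B" "B \<noteq> C" "C \<noteq> A" using nc by (auto simp: insert_commute)
  have coords: "\<exists>x y. P $ 1 = H $ 1 + of_int x \<and> P $ 2 = H $ 2 + of_int y"
    if "P \<in> lattice_points" for P
  proof -
    have "P $ 1 - H $ 1 \<in> \<int>" "P $ 2 - H $ 2 \<in> \<int>" using that H by (auto simp: lattice_points_2)
    then show ?thesis by (metis Ints_cases add_diff_cancel_left' diff_add_cancel add.commute)
  qed
  obtain a1 a2 where a: "A $ 1 = H $ 1 + of_int a1" "A $ 2 = H $ 2 + of_int a2" using coords lat by blast
  obtain b1 b2 where b: "B $ 1 = H $ 1 + of_int b1" "B $ 2 = H $ 2 + of_int b2" using coords lat by blast
  obtain c1 c2 where c: "C $ 1 = H $ 1 + of_int c1" "C $ 2 = H $ 2 + of_int c2" using coords lat by blast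
  define K where "K = - (a1 * b1 + a2 * b2)"
  have "H \<in> altitude A B C" "H \<in> altitude B C A" "H \<in> altitude C A B"
    using orth by (auto simp: is_orthocenter_def)
  \<comment> \<open>Perpendicularity to the opposite side equates the inner products of pairs of
    vertices, taken relative to \<open>H\<close>.\<close>
  then have "real_of_int (a1 * (c1 - b1) + a2 * (c2 - b2)) = 0"
    "real_of_int (b1 * (a1 - c1) + b2 * (a2 - c2)) = 0"
    unfolding altitude_def orthogonal_def mem_Collect_eq inner_real2
    by (simp_all add: a b c algebra_simps)
  then have perp: "a1 * (c1 - b1) + a2 * (c2 - b2) = 0" "b1 * (a1 - c1) + b2 * (a2 - c2) = 0"
    unfolding of_int_eq_0_iff by auto
  have ab: "a1 * b1 + a2 * b2 = - K" by (simp add: K_def)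
  have ca: "c1 * a1 + c2 * a2 = - K" using perp(1) ab by algebra
  have bc: "b1 * c1 + b2 * c2 = - K" using perp(2) ab by algebra
  have "real_of_int ((b1 - a1) * (c1 - a1) + (b2 - a2) * (c2 - a2)) > 0"
    "real_of_int ((c1 - b1) * (a1 - b1) + (c2 - b2) * (a2 - b2)) > 0"
    "real_of_int ((a1 - c1) * (b1 - c1) + (a2 - c2) * (b2 - c2)) > 0"
    using acute unfolding acute_triangle_iff[OF ne] inner_real2 by (simp_all add: a b c)
  then have "(b1 - a1) * (c1 - a1) + (b2 - a2) * (c2 - a2) > 0"
    "(c1 - b1) * (a1 - b1) + (c2 - b2) * (a2 - b2) > 0"
    "(a1 - c1) * (b1 - c1) + (a2 - c2) * (b2 - c2) > 0"
    unfolding of_int_0_less_iff by auto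
  moreover have "(b1 - a1) * (c1 - a1) + (b2 - a2) * (c2 - a2) = a1 * a1 + a2 * a2 + K"
    "(c1 - b1) * (a1 - b1) + (c2 - b2) * (a2 - b2) = b1 * b1 + b2 * b2 + K"
    "(a1 - c1) * (b1 - c1) + (a2 - c2) * (b2 - c2) = c1 * c1 + c2 * c2 + K"
    using ab bc ca by algebra+
  ultimately have pos: "a1 * a1 + a2 * a2 + K > 0" "b1 * b1 + b2 * b2 + K > 0"
    "c1 * c1 + c2 * c2 + K > 0" by simp_all
  have "int (lattice_length B C) = gcd (c1 - b1) (c2 - b2)"
    "int (lattice_length C A) = gcd (a1 - c1) (a2 - c2)"
    "int (lattice_length A B) = gcd (b1 - a1) (b2 - a2)"
    using lat by (auto intro!: lattice_length_eq_gcd simp: a b c)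
  then have "int (lattice_perimeter A B C) = gcd (c1 - b1) (c2 - b2) + gcd (a1 - c1) (a2 - c2) +
    gcd (b1 - a1) (b2 - a2)" by (simp add: lattice_perimeter_def)
  then show ?thesis using orthocentric_int_perimeter[OF ab bc ca pos] by linarith
qed

section \<open>Construction of triangles with prescribed perimeter\<close>

text \<open>With the foot of the altitude from \<open>A\<close> at the origin, the other altitudes
  meet the vertical axis at height \<open>u * v / h = w\<close>.\<close>

lemma orthocentric_lattice_triangle_exists:
  fixes u v h w :: nat
  assumes uv: "u * v = h * w" and w: "0 < w" "w < h" and l: "l = u + v + gcd u h + gcd v h"
  shows "\<exists>A B C H. lattice_triangle A B C \<and> acute_triangle A B C \<and>
    lattice_perimeter A B C = l \<and> is_orthocenter H A B C \<and> H \<in> lattice_points"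
proof -
  define A B C H :: "real^2" where "A = vector [0, real h]" and "B = vector [- real u, 0]"
    and "C = vector [real v, 0]" and "H = vector [0, real w]"
  have "u * v > 0" using uv w by simp
  then have pos: "real u > 0" "real v > 0" "real h > 0" using w by auto
  have uv': "real u * real v = real h * real w" using uv by (metis of_nat_mult)
  have lat: "A \<in> lattice_points" "B \<in> lattice_points" "C \<in> lattice_points" "H \<in> lattice_points"
    by (simp_all add: A_def B_def C_def H_def lattice_points_2)
  have ne: "A \<noteq> B" "B \<noteq> C" "C \<noteq> A"
    using pos by (auto simp: A_def B_def C_def vec_eq_iff forall_2)
  have "\<not> collinear {A, B, C}"
  proof
    assume "collinear {A, B, C}"
    then have "collinear {0, A - B, C - B}" by (simp add: collinear_3[of A B C])
    then consider "A - B = 0" | "C - B = 0" | k where "C - B = k *\<^sub>R (A - B)"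
      using collinear_lemma by blast
    then show False
      by cases (use ne pos in \<open>auto simp: A_def B_def C_def vec_eq_iff forall_2\<close>)
  qed
  then have tri: "lattice_triangle A B C" using lat by (simp add: lattice_triangle_def)
  \<comment> \<open>This is acuteness at \<open>A\<close>, where the inner product is
    \<open>h * h - u * v\<close>.\<close>
  have "real h * real w < real h * real h" using w by simp
  then have acute: "acute_triangle A B C"
    unfolding acute_triangle_iff[OF ne] inner_real2 using pos uv'
    by (simp add: A_def B_def C_def algebra_simps add_pos_pos mult_pos_pos add_nonneg_pos)
  have "int (lattice_length B C) = gcd (int (u + v)) 0"
    "int (lattice_length C A) = gcd (- int v) (int h)"
    "int (lattice_length A B) = gcd (- int u) (- int h)"
    by (rule lattice_length_eq_gcd; use lat in \<open>simp add: A_def B_def C_def\<close>)+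
  then have "lattice_perimeter A B C = l" by (simp add: lattice_perimeter_def l)
  moreover have "altitude A B C \<inter> altitude B C A \<inter> altitude C A B = {H}"
  proof -
    have "P \<in> altitude A B C \<inter> altitude B C A \<inter> altitude C A B \<longleftrightarrow> P = H" for P
    proof -
      have "P \<in> altitude A B C \<longleftrightarrow> P $ 1 = 0"
        using pos by (auto simp: altitude_def orthogonal_def inner_real2 A_def B_def C_def)
      moreover have "P \<in> altitude B C A \<longleftrightarrow> real h * P $ 2 = (P $ 1 + real u) * real v"
        by (auto simp: altitude_def orthogonal_def inner_real2 A_def B_def C_def algebra_simps)
      moreover have "P \<in> altitude C A B \<longleftrightarrow> real h * P $ 2 = (real v - P $ 1) * real u"
        by (auto simp: altitude_def orthogonal_def inner_real2 A_def B_def C_def algebra_simps)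
      moreover have "P = H \<longleftrightarrow> P $ 1 = 0 \<and> real h * P $ 2 = real h * real w"
        using pos by (auto simp: H_def vec_eq_iff forall_2)
      ultimately show ?thesis using uv' by (auto simp: mult.commute)
    qed
    then show ?thesis by blast
  qed
  ultimately show ?thesis using tri acute lat(4) unfolding is_orthocenter_def by blast
qed

theorem theorem1:
  fixes l :: nat
  assumes "l \<ge> 1"
  shows "(\<exists>A B C H. lattice_triangle A B C \<and> acute_triangle A B C \<and>
            lattice_perimeter A B C = l \<and> is_orthocenter H A B C \<and> H \<in> lattice_points)
         \<longleftrightarrow> l = 6 \<or> l \<ge> 8" (is "?exists \<longleftrightarrow> _")
proof
  assume ?exists
  then show "l = 6 \<or> l \<ge> 8" using lattice_perimeter_orthocentric by blast
next
  assume l: "l = 6 \<or> l \<ge> 8"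
  have family: ?exists if "0 < k" "k < n" "l = k + 2 * n + gcd k n" for k n
    using that by (intro orthocentric_lattice_triangle_exists[of k n n k]) auto
  \<comment> \<open>Even \<open>l\<close> takes \<open>k = 1\<close>, residue 1 modulo 4 takes
    \<open>k = 2\<close>, residue 3 takes \<open>k = 4\<close>. For \<open>l = 11\<close> the last
    choice would give \<open>n = 3\<close>, violating \<open>k < n\<close>.\<close>
  have "even l \<or> l = 11 \<or> l = 4 * ((l - 9) div 4) + 9 \<or> l = 4 * ((l - 15) div 4) + 15"
    using l by presburger
  then consider "even l" | "l = 11" | m where "l = 4 * m + 9" | m where "l = 4 * m + 15"
    by blast
  then show ?exists
  proof cases
    case 1
    then obtain m where "l = 2 * m" by blast
    then show ?thesis using l by (intro family[of 1 "m - 1"]) auto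
  next
    case 2
    then show ?thesis by (intro orthocentric_lattice_triangle_exists[of 6 1 3 2]) (auto simp: gcd_nat.simps)
  next
    case (3 m)
    have "gcd 2 (2 * m + 3) = 1"
      by (simp add: coprime_left_2_iff_odd flip: coprime_iff_gcd_eq_1)
    then show ?thesis using 3 by (intro family[of 2 "2 * m + 3"]) simp_all
  next
    case (4 m)
    have "coprime (2 ^ 2) (2 * m + 5)"
      unfolding coprime_power_left_iff coprime_left_2_iff_odd by simp
    then have "gcd 4 (2 * m + 5) = 1" by (simp flip: coprime_iff_gcd_eq_1)
    then show ?thesis using 4 by (intro family[of 4 "2 * m + 5"]) simp_all
  qed
qed

end
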